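(* Let $m,n$ be positive integers such that $m(m+1)<2\lceil n/2\rceil$, and write $[a,b]=\{a,a+1,\ldots,b\}$. Then \[ \ell_q([m,n])=\ell_q([1,n])=\frac12\left(\frac{n(n+1)}{2}+\left\lceil\frac n2\right\rceil\right). \]
   Context: All graphs are finite and simple. The degree set of a graph is the set of distinct degrees of its vertices. For a finite nonempty set $\mathscr D$ of positive integers, $\ell_q(\mathscr D)$ denotes the least number of edges of a simple graph whose degree set is exactly $\mathscr D$. *)

theory Defs
  imports Complex_Main
begin

definition simple_graph :: "'a set \<Rightarrow> 'a set set \<Rightarrow> bool" where
  "simple_graph V E \<longleftrightarrow> finite V \<and> (\<forall>e\<in>E. e \<subseteq> V \<and> card e = 2)"

definition degree :: "'a set set \<Rightarrow> 'a \<Rightarrow> nat" where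
  "degree E v = card {e \<in> E. v \<in> e}"

definition degree_set :: "'a set \<Rightarrow> 'a set set \<Rightarrow> nat set" where
  "degree_set V E = degree E ` V"

text \<open>Vertices are natural numbers; by \<open>simple_graph_relabel_nat\<close> below this is no
  restriction on the graphs considered.\<close>

definition lq :: "nat set \<Rightarrow> nat" where
  "lq D = (LEAST q. \<exists>(V :: nat set) E. simple_graph V E \<and> degree_set V E = D \<and> card E = q)"

lemma simple_graph_relabel_nat:
  fixes V :: "'a set"
  assumes "simple_graph V E"
  shows "\<exists>(V' :: nat set) E'. simple_graph V' E' \<and> degree_set V' E' = degree_set V E
           \<and> card E' = card E"
proof -
  have fin: "finite V" and E: "\<And>e. e \<in> E \<Longrightarrow> e \<subseteq> V \<and> card e = 2"
    using assms by (auto simp: simple_graph_def)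
  obtain f :: "'a \<Rightarrow> nat" where f: "inj_on f V"
    using finite_imp_inj_to_nat_seg[OF fin] by blast
  have inj: "inj_on (image f) E"
    using E f by (meson inj_on_def inj_on_image_eq_iff)
  have sg: "simple_graph (f ` V) (image f ` E)"
    unfolding simple_graph_def
  proof (intro conjI ballI)
    fix e assume "e \<in> image f ` E"
    then obtain d where d: "d \<in> E" "e = f ` d" by blast
    show "e \<subseteq> f ` V" using d E by blast
    show "card e = 2" using d E f by (metis card_image inj_on_subset)
  qed (use fin in simp)
  have deg: "degree (image f ` E) (f v) = degree E v" if v: "v \<in> V" for v
  proof -
    have "{e \<in> image f ` E. f v \<in> e} = image f ` {e \<in> E. v \<in> e}"
      using inj_on_image_mem_iff[OF f v] E by blast
    moreover have "inj_on (image f) {e \<in> E. v \<in> e}"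
      using inj by (rule inj_on_subset) auto
    ultimately show ?thesis by (simp add: degree_def card_image)
  qed
  have "degree_set (f ` V) (image f ` E) = degree_set V E"
    using deg by (simp add: degree_set_def image_image)
  with sg show ?thesis using card_image[OF inj] by blast
qed

end

theory Submission
  imports Defs
begin

text \<open>Put \<open>k = \<lceil>n/2\<rceil>\<close>; the common value is \<open>k (n + 1 - k)\<close>. For the lower bound, take one vertex of
  each of the \<open>k\<close> largest degrees \<open>n - k + 1, \<dots>, n\<close>: each edge is counted at most twice in the sum of
  these degrees, and at most \<open>k choose 2\<close> edges are counted twice. For the upper bound, start with the
  antiregular graph on \<open>n + 1\<close> vertices, whose degrees are \<open>1, \<dots>, n\<close> with \<open>k\<close> repeated. Moving the end
  of an edge from a vertex of larger degree to one of smaller degree keeps the number of edges, so one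
  of the two vertices of degree \<open>k\<close> can raise the degrees \<open>1, \<dots>, m - 1\<close> to \<open>m\<close>; it loses
  \<open>m (m - 1) / 2\<close> in the process and still has degree at least \<open>m\<close>.\<close>

section \<open>Degrees and double counting\<close>

lemma simple_graph_finite_edges:
  assumes "simple_graph V E"
  shows "finite E"
proof (rule finite_subset)
  show "E \<subseteq> Pow V" "finite (Pow V)" using assms by (auto simp: simple_graph_def)
qed

lemma degree_eq_card_neighbours:
  assumes "simple_graph V E"
  shows "degree E v = card {w. {v, w} \<in> E}"
proof -
  have ne: "w \<noteq> v" if "{v, w} \<in> E" for w
    using assms that by (force simp: simple_graph_def)
  have "{e \<in> E. v \<in> e} = (\<lambda>w. {v, w}) ` {w. {v, w} \<in> E}"
  proof (intro equalityI subsetI)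
    fix e assume e: "e \<in> {e \<in> E. v \<in> e}"
    then have "card e = 2" using assms by (simp add: simple_graph_def)
    then obtain x y where "e = {x, y}" by (auto simp: card_2_iff)
    with e have "\<exists>w. e = {v, w}" by (auto simp: insert_commute)
    with e show "e \<in> (\<lambda>w. {v, w}) ` {w. {v, w} \<in> E}" by auto
  qed auto
  moreover have "inj_on (\<lambda>w. {v, w}) {w. {v, w} \<in> E}"
    using ne by (auto simp: inj_on_def doubleton_eq_iff)
  ultimately show ?thesis by (simp add: degree_def card_image)
qed

lemma sum_degree_eq:
  assumes "finite S" "finite E"
  shows "(\<Sum>v\<in>S. degree E v) = (\<Sum>e\<in>E. card (e \<inter> S))"
proof -
  have "(\<Sum>v\<in>S. degree E v) = (\<Sum>v\<in>S. \<Sum>e\<in>E. if v \<in> e then 1 else 0)"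
    using assms by (simp add: degree_def sum.If_cases Int_def)
  also have "\<dots> = (\<Sum>e\<in>E. \<Sum>v\<in>S. if v \<in> e then 1 else 0)"
    by (rule sum.swap)
  also have "\<dots> = (\<Sum>e\<in>E. card (e \<inter> S))"
    using assms by (simp add: sum.If_cases Int_def conj_commute)
  finally show ?thesis .
qed

lemma handshake:
  assumes "simple_graph V E"
  shows "(\<Sum>v\<in>V. degree E v) = 2 * card E"
proof -
  have "(\<Sum>v\<in>V. degree E v) = (\<Sum>e\<in>E. card (e \<inter> V))"
    using assms by (intro sum_degree_eq simple_graph_finite_edges) (auto simp: simple_graph_def)
  also have "\<dots> = (\<Sum>e\<in>E. 2)"
    using assms by (intro sum.cong) (auto simp: simple_graph_def Int_absorb2)
  finally show ?thesis by simp
qed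

section \<open>Lower bound on the number of edges\<close>

text \<open>An edge adds one to the sum for each end in \<open>S\<close>, hence at most one unless
  it lies inside \<open>S\<close>; the edges inside \<open>S\<close> are among its
  2-subsets.\<close>

lemma sum_degree_le:
  assumes G: "simple_graph V E" and S: "S \<subseteq> V"
  shows "(\<Sum>v\<in>S. degree E v) \<le> card E + (card S choose 2)"
proof -
  have fE: "finite E" and fS: "finite S"
    using simple_graph_finite_edges[OF G] G S finite_subset by (auto simp: simple_graph_def)
  have "(\<Sum>v\<in>S. degree E v) = (\<Sum>e\<in>E. card (e \<inter> S))"
    by (rule sum_degree_eq[OF fS fE])
  also have "\<dots> \<le> (\<Sum>e\<in>E. 1 + (if e \<subseteq> S then 1 else 0))"
  proof (rule sum_mono)
    fix e assume "e \<in> E"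
    then have c: "card e = 2" using G by (simp add: simple_graph_def)
    then have fe: "finite e" using card.infinite by fastforce
    show "card (e \<inter> S) \<le> 1 + (if e \<subseteq> S then 1 else 0)"
    proof (cases "e \<subseteq> S")
      case True
      then show ?thesis using c by (simp add: Int_absorb2)
    next
      case False
      then have "e \<inter> S \<subset> e" by blast
      then have "card (e \<inter> S) < card e" using fe by (simp add: psubset_card_mono)
      then show ?thesis using c by simp
    qed
  qed
  also have "\<dots> = card E + card {e \<in> E. e \<subseteq> S}"
    unfolding sum.distrib using fE by (simp add: sum.If_cases Int_def)
  also have "card {e \<in> E. e \<subseteq> S} \<le> card {e. e \<subseteq> S \<and> card e = 2}"
    using G fS by (intro card_mono) (auto simp: simple_graph_def)
  also have "\<dots> = card S choose 2" by (rule n_subsets[OF fS])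
  finally show ?thesis by simp
qed

text \<open>The \<open>r\<close> largest degrees add up to \<open>r * (2 * n + 1 - r) / 2\<close>,
  and subtracting \<open>r * (r - 1) / 2\<close> leaves the bound. The later choice
  \<open>r = k\<close> makes it as large as possible.\<close>

lemma card_edges_ge:
  assumes G: "simple_graph V E" and D: "{Suc n - r..n} \<subseteq> degree_set V E" and r: "r \<le> n"
  shows "r * (Suc n - r) \<le> card E"
proof -
  from D obtain S where S: "S \<subseteq> V" and inj: "inj_on (degree E) S"
    and im: "{Suc n - r..n} = degree E ` S"
    unfolding degree_set_def by (auto simp: subset_image_inj)
  have cS: "card S = r" using card_image[OF inj] r by (simp flip: im)
  have "\<Sum>{Suc n - r..n} = (\<Sum>v\<in>S. degree E v)"
    unfolding im by (simp add: sum.reindex[OF inj])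
  also have "\<dots> \<le> card E + (r choose 2)" using sum_degree_le[OF G S] cS by simp
  finally have le: "2 * \<Sum>{Suc n - r..n} \<le> 2 * card E + 2 * (r choose 2)" by simp
  \<comment> \<open>Doubling avoids division; each induction step adds the new smallest term
    \<open>n - r\<close>.\<close>
  have "2 * \<Sum>{Suc n - r..n} = r * (n + (Suc n - r))"
    using r
  proof (induction r)
    case (Suc r)
    then have "{Suc n - Suc r..n} = insert (n - r) {Suc n - r..n}" by auto
    with Suc show ?case by (auto simp: algebra_simps Suc_diff_le dest!: le_Suc_ex)
  qed simp
  moreover have "2 * (r choose 2) = r * (r - 1)" 
    by (cases r) (simp_all add: choose_two)
  ultimately have "r * (n + (Suc n - r)) \<le> 2 * card E + r * (r - 1)" using le by simp
  moreover obtain d where "n = r + d" using r le_Suc_ex by blast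
  ultimately show ?thesis by (cases r) (simp_all add: algebra_simps)
qed

section \<open>Moving ends of edges\<close>

text \<open>Having more neighbours than \<open>v\<close>, the vertex \<open>u\<close> has a
  neighbour \<open>w\<close> other than \<open>v\<close> that is not adjacent to \<open>v\<close>.
  Replacing the edge \<open>{u, w}\<close> by \<open>{v, w}\<close> leaves the degree of
  \<open>w\<close> alone.\<close>

lemma transfer_edge:
  assumes G: "simple_graph V E" and uv: "u \<in> V" "v \<in> V" and less: "degree E v < degree E u"
  obtains E' where "simple_graph V E'" "card E' = card E"
    "degree E' u = degree E u - 1" "degree E' v = degree E v + 1"
    "\<And>x. x \<noteq> u \<Longrightarrow> x \<noteq> v \<Longrightarrow> degree E' x = degree E x"
proof -
  have fE: "finite E" by (rule simple_graph_finite_edges[OF G])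
  have nb: "w \<in> V \<and> w \<noteq> x" if "{x, w} \<in> E" for x w
    using G that by (force simp: simple_graph_def)
  have fN: "finite {w. {x, w} \<in> E}" for x
  proof (rule finite_subset)
    show "{w. {x, w} \<in> E} \<subseteq> V" using nb by blast
    show "finite V" using G by (simp add: simple_graph_def)
  qed
  have "\<exists>w. {u, w} \<in> E \<and> w \<noteq> v \<and> {v, w} \<notin> E"
  proof (rule ccontr)
    assume "\<not> ?thesis"
    then have "{w. {u, w} \<in> E} - {v} \<subseteq> {w. {v, w} \<in> E} - {u}" using nb by blast
    then have "card ({w. {u, w} \<in> E} - {v}) \<le> card ({w. {v, w} \<in> E} - {u})"
      using fN by (intro card_mono) auto
    \<comment> \<open>Adjacency is symmetric, so the two deletions shrink both neighbourhoods or
      neither, and the comparison carries over to the full ones.\<close>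
    moreover have "v \<in> {w. {u, w} \<in> E} \<longleftrightarrow> u \<in> {w. {v, w} \<in> E}" by (simp add: insert_commute)
    moreover have "0 < card {w. {v, w} \<in> E}" if "u \<in> {w. {v, w} \<in> E}"
      using that fN by (subst card_gt_0_iff) blast
    ultimately have "card {w. {u, w} \<in> E} \<le> card {w. {v, w} \<in> E}"
      by (fastforce simp: card_Diff_singleton_if split: if_splits)
    with less show False by (simp add: degree_eq_card_neighbours[OF G])
  qed
  then obtain w where w: "{u, w} \<in> E" "w \<noteq> v" "{v, w} \<notin> E" by blast
  have wV: "w \<in> V" "w \<noteq> u" and ne: "u \<noteq> v" using nb[OF w(1)] less by auto
  define E' where "E' = insert {v, w} (E - {{u, w}})"
  have d: "degree E' x = card ({e \<in> E. x \<in> e} - (if x \<in> {u, w} then {{u, w}} else {}))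
    + (if x \<in> {v, w} then 1 else 0)" for x
  proof -
    have "{e \<in> E'. x \<in> e} = ({e \<in> E. x \<in> e} - (if x \<in> {u, w} then {{u, w}} else {}))
      \<union> (if x \<in> {v, w} then {{v, w}} else {})"
      by (auto simp: E'_def)
    then show ?thesis using fE w(3) unfolding degree_def by (auto simp: card_insert_if)
  qed
  \<comment> \<open>At \<open>w\<close> one edge is lost and one gained; positivity lets the
    truncated subtraction cancel.\<close>
  have pos: "card {e \<in> E. x \<in> e} > 0" if "x \<in> {u, w}" for x
    using fE w(1) that by (subst card_gt_0_iff) auto
  show thesis
  proof
    show "simple_graph V E'"
      using G uv wV w(2) by (auto simp: simple_graph_def E'_def)
    show "card E' = card E"
      using fE w card_gt_0_iff[of E] by (auto simp: E'_def card_insert_if card_Diff_singleton_if)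
    show "degree E' u = degree E u - 1"
      using d[of u] ne w wV by (simp add: degree_def card_Diff_singleton_if)
    show "degree E' v = degree E v + 1"
      using d[of v] ne w wV by (simp add: degree_def)
    fix x assume "x \<noteq> u" "x \<noteq> v"
    then show "degree E' x = degree E x"
      using d[of x] pos[of x] w by (auto simp: degree_def card_Diff_singleton_if)
  qed
qed

text \<open>Induction on the total deficit of \<open>S\<close> below \<open>m\<close>. A transfer
  from \<open>u\<close> to a deficient vertex lowers both the deficit and the degree of
  \<open>u\<close> by one, so the last assumption persists; it also keeps \<open>u\<close> at degree
  at least \<open>m\<close>, above every deficient vertex.\<close>

lemma raise_degrees:
  assumes "simple_graph V E" "u \<in> V" "S \<subseteq> V" "u \<notin> S"
    and "\<And>v. v \<in> S \<Longrightarrow> degree E v \<le> m"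
    and "m + (\<Sum>v\<in>S. m - degree E v) \<le> degree E u"
  shows "\<exists>E'. simple_graph V E' \<and> card E' = card E \<and> (\<forall>v\<in>S. degree E' v = m)
    \<and> m \<le> degree E' u \<and> degree E' u \<le> degree E u
    \<and> (\<forall>x. x \<notin> S \<longrightarrow> x \<noteq> u \<longrightarrow> degree E' x = degree E x)"
  using assms
proof (induction "\<Sum>v\<in>S. m - degree E v" arbitrary: E rule: less_induct)
  case less
  have fS: "finite S" using less.prems(1,3) finite_subset by (auto simp: simple_graph_def)
  show ?case
  proof (cases "\<forall>v\<in>S. degree E v = m")
    case True
    then show ?thesis using less.prems by (intro exI[of _ E]) auto
  next
    case False
    then obtain v where v: "v \<in> S" "degree E v < m"
      using less.prems(5) le_neq_implies_less by blast
    have "degree E v < degree E u" using v less.prems(6) by linarith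
    then obtain E1 where E1: "simple_graph V E1" "card E1 = card E"
      "degree E1 u = degree E u - 1" "degree E1 v = degree E v + 1"
      "\<And>x. x \<noteq> u \<Longrightarrow> x \<noteq> v \<Longrightarrow> degree E1 x = degree E x"
      using transfer_edge[OF less.prems(1,2), of v] v(1) less.prems(3) by blast
    have "(\<Sum>x\<in>S - {v}. m - degree E1 x) = (\<Sum>x\<in>S - {v}. m - degree E x)"
      using less.prems(4) by (intro sum.cong refl) (metis E1(5) DiffE singletonI)
    then have sum: "(\<Sum>x\<in>S. m - degree E x) = Suc (\<Sum>x\<in>S. m - degree E1 x)"
      using v E1(4) fS by (simp add: sum.remove)
    have le: "degree E1 x \<le> m" if "x \<in> S" for x
      using that v less.prems(4,5) E1(4,5) by (cases "x = v") (auto, metis)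
    have "m + (\<Sum>v\<in>S. m - degree E1 v) \<le> degree E1 u" using sum E1(3) less.prems(6) by linarith
    then obtain E2 where "simple_graph V E2" "card E2 = card E1" "\<forall>v\<in>S. degree E2 v = m"
      "m \<le> degree E2 u" "degree E2 u \<le> degree E1 u"
      "\<forall>x. x \<notin> S \<longrightarrow> x \<noteq> u \<longrightarrow> degree E2 x = degree E1 x"
      using less.hyps[OF _ E1(1) less.prems(2-4) le] sum by auto
    then show ?thesis using E1 v(1) by (intro exI[of _ E2]) auto
  qed
qed

section \<open>The antiregular graph\<close>

text \<open>Presented as a threshold graph with labels as weights, so that neighbourhoods are, up to
  the vertex itself, nested final segments.\<close>

definition antiregular :: "nat \<Rightarrow> nat set set" where
  "antiregular N = {{i, j} |i j. i \<in> {1..N} \<and> j \<in> {1..N} \<and> i \<noteq> j \<and> N < i + j}"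

lemma simple_graph_antiregular: "simple_graph {1..N} (antiregular N)"
  by (auto simp: simple_graph_def antiregular_def)

text \<open>The neighbours of \<open>i\<close> are the \<open>i\<close> largest labels, without
  \<open>i\<close> itself, which is among them exactly when \<open>2 * i > N\<close>.\<close>

lemma degree_antiregular:
  assumes "i \<in> {1..N}"
  shows "degree (antiregular N) i = (if 2 * i \<le> N then i else i - 1)"
proof -
  have "{w. {i, w} \<in> antiregular N} = {Suc N - i..N} - {i}"
  proof (intro equalityI subsetI)
    fix w assume "w \<in> {Suc N - i..N} - {i}"
    then have "w \<in> {1..N}" "i \<noteq> w" "N < i + w" using assms by auto
    then show "w \<in> {w. {i, w} \<in> antiregular N}"
      using assms unfolding antiregular_def by blast
  qed (auto simp: antiregular_def doubleton_eq_iff)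
  then show ?thesis
    using assms by (auto simp: degree_eq_card_neighbours[OF simple_graph_antiregular])
qed

text \<open>The degrees are \<open>1, ..., k\<close> followed by \<open>k, ..., n\<close>, so twice
  the number of edges is \<open>n * (n + 1) / 2 + k\<close>; either parity of \<open>n\<close> gives
  the product.\<close>

lemma card_antiregular:
  assumes k: "k = Suc n div 2"
  shows "card (antiregular (Suc n)) = k * (Suc n - k)"
proof -
  have "2 * card (antiregular (Suc n)) = (\<Sum>i=1..Suc n. degree (antiregular (Suc n)) i)"
    by (rule handshake[OF simple_graph_antiregular, symmetric])
  also have "\<dots> = (\<Sum>i=1..Suc n. if i \<le> k then i else i - 1)"
    using k by (intro sum.cong refl) (auto simp: degree_antiregular)
  also have "\<dots> = (\<Sum>i=1..k. i) + (\<Sum>i=Suc k..Suc n. i - 1)"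
  proof -
    have "{1..Suc n} = {1..k} \<union> {Suc k..Suc n}" using k by auto
    then show ?thesis by (simp only:) (subst sum.union_disjoint; auto intro!: sum.cong)
  qed
  also have "(\<Sum>i=Suc k..Suc n. i - 1) = (\<Sum>i=k..n. i)"
    by (subst sum.shift_bounds_cl_Suc_ivl) simp
  finally have "2 * card (antiregular (Suc n)) = \<Sum>{1..k} + \<Sum>{k..n}" .
  moreover have "\<Sum>{1..k} + \<Sum>{k..n} = \<Sum>{..n} + k"
  proof -
    have "{..n} = insert 0 ({1..k} \<union> {Suc k..n})" using k by auto
    then have "\<Sum>{..n} = \<Sum>{1..k} + \<Sum>{Suc k..n}" by (simp add: sum.union_disjoint)
    moreover have "{k..n} = insert k {Suc k..n}" using k by auto
    ultimately show ?thesis by simp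
  qed
  moreover have "2 * \<Sum>{..n} = n * Suc n" using double_gauss_sum[of n, where 'a = nat]
    by (simp add: atMost_atLeast0)
  ultimately have "4 * card (antiregular (Suc n)) = n * Suc n + 2 * k" by linarith
  moreover have "n = 2 * k \<or> Suc n = 2 * k" using k by linarith
  ultimately show ?thesis by (cases k) (auto simp: algebra_simps)
qed

section \<open>The value for intervals\<close>

text \<open>The bound on \<open>m\<close> says that \<open>1 + ... + m \<le> k\<close>: a vertex of
  degree \<open>k\<close> can cover the deficits of the degrees below \<open>m\<close> and keep
  degree \<open>m\<close>.\<close>

lemma lq_interval:
  assumes k: "k = Suc n div 2" and m: "m \<ge> 1" and mk: "m * (m + 1) \<le> 2 * k"
  shows "lq {m..n} = k * (Suc n - k)"
  unfolding lq_def
proof (rule Least_equality)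
  have "m * 2 \<le> m * (m + 1)" using m by (intro mult_le_mono) auto
  also have "\<dots> \<le> 2 * k" by (rule mk)
  finally have mlek: "m \<le> k" by simp
  then have kn: "k \<le> n" "2 * k \<le> Suc n" "n \<le> 2 * k" using k m by auto
  let ?V = "{1..Suc n}" and ?A = "antiregular (Suc n)"
  have deg: "degree ?A i = (if i \<le> k then i else i - 1)" if "i \<in> ?V" for i
    using degree_antiregular[OF that] k by auto
  have "(\<Sum>v\<in>{1..<m}. m - degree ?A v) = (\<Sum>v\<in>{1..<m}. m - v)"
    using mlek kn by (intro sum.cong refl) (auto simp: deg)
  also have "\<dots> = (\<Sum>v\<in>{1..<m}. v)"
    by (rule sum.reindex_bij_witness[of _ "\<lambda>i. m - i" "\<lambda>i. m - i"]) auto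
  finally have "m + (\<Sum>v\<in>{1..<m}. m - degree ?A v) = (\<Sum>v\<in>{1..m}. v)"
    using m by (simp add: atLeastLessThanSuc_atLeastAtMost[symmetric] del: One_nat_def)
  also have "\<dots> \<le> k" using mk gauss_sum_from_Suc_0[of m, where 'a = nat] by simp
  \<comment> \<open>The donor is \<open>Suc k\<close>; its twin, the vertex \<open>k\<close>, still
    provides the degree \<open>k\<close>.\<close>
  also have "k = degree ?A (Suc k)" using deg[of "Suc k"] kn by simp
  finally have "m + (\<Sum>v\<in>{1..<m}. m - degree ?A v) \<le> degree ?A (Suc k)" .
  moreover have "Suc k \<in> ?V" "{1..<m} \<subseteq> ?V" "Suc k \<notin> {1..<m}" using mlek kn by auto
  moreover have "degree ?A v \<le> m" if "v \<in> {1..<m}" for v using deg[of v] that mlek kn by auto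
  ultimately obtain E where E: "simple_graph ?V E" "card E = card ?A"
    "\<And>v. v \<in> {1..<m} \<Longrightarrow> degree E v = m"
    "m \<le> degree E (Suc k)" "degree E (Suc k) \<le> degree ?A (Suc k)"
    "\<And>x. x \<notin> {1..<m} \<Longrightarrow> x \<noteq> Suc k \<Longrightarrow> degree E x = degree ?A x"
    using raise_degrees[OF simple_graph_antiregular, of "Suc k" "Suc n" "{1..<m}" m] by metis
  have "degree_set ?V E = {m..n}"
    unfolding degree_set_def
  proof (intro equalityI subsetI)
    fix d assume "d \<in> degree E ` ?V"
    then obtain v where v: "v \<in> ?V" "d = degree E v" by blast
    consider "v \<in> {1..<m}" | "v = Suc k" | "v \<notin> {1..<m}" "v \<noteq> Suc k" by blast
    then show "d \<in> {m..n}"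
    proof cases
      case 1
      then show ?thesis using v E(3) mlek kn by simp
    next
      case 2
      then show ?thesis using v E(4,5) deg[of "Suc k"] kn by simp
    next
      case 3
      then show ?thesis using v E(6) deg[of v] mlek kn by auto
    qed
  next
    fix d assume d: "d \<in> {m..n}"
    \<comment> \<open>This label skips the donor \<open>Suc k\<close> and is at least
      \<open>m\<close>, so its degree was not changed.\<close>
    let ?v = "if d \<le> k then d else Suc d"
    have "?v \<in> ?V" using d m by auto
    moreover have "degree E ?v = d" using E(6)[of ?v] deg[of ?v] d m by auto
    ultimately show "d \<in> degree E ` ?V" by (metis imageI)
  qed
  then show "\<exists>(V :: nat set) E. simple_graph V E \<and> degree_set V E = {m..n} \<and> card E = k * (Suc n - k)"
    using E(1,2) card_antiregular[OF k] by auto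
  fix q assume "\<exists>(V :: nat set) E. simple_graph V E \<and> degree_set V E = {m..n} \<and> card E = q"
  \<comment> \<open>Since \<open>m \<le> k \<le> Suc n - k\<close>, the \<open>k\<close> largest
    degrees all lie in \<open>{m..n}\<close>.\<close>
  then show "k * (Suc n - k) \<le> q"
    using card_edges_ge[of _ _ n k] mlek kn by force
qed

theorem theorem7:
  fixes m n :: nat
  assumes "m \<ge> 1" and "n \<ge> 1"
    and "int (m * (m + 1)) < 2 * \<lceil>real n / 2\<rceil>"
  shows "lq {m..n} = lq {1..n} \<and>
    real (lq {1..n}) = 1 / 2 * (real n * (real n + 1) / 2 + real_of_int \<lceil>real n / 2\<rceil>)"
proof -
  define k where "k = Suc n div 2"
  have parity: "n = 2 * k \<or> Suc n = 2 * k" unfolding k_def by linarith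
  have ceil: "\<lceil>real n / 2\<rceil> = int k"
    using parity by (intro ceiling_unique) auto
  have mk: "m * (m + 1) \<le> 2 * k" using assms(3) unfolding ceil by linarith
  \<comment> \<open>The case \<open>m = 1\<close> of the bound, from
    \<open>n \<ge> 1\<close>.\<close>
  have "1 * (1 + 1) \<le> 2 * k" using parity assms(2) by auto
  then have one: "lq {1..n} = k * (Suc n - k)" by (intro lq_interval[OF k_def]) auto
  have "real (k * (Suc n - k)) = 1 / 2 * (real n * (real n + 1) / 2 + real k)"
  proof -
    have "real (Suc n - k) = real n + 1 - real k" using parity by (auto simp: of_nat_diff)
    moreover have "real n = 2 * real k \<or> real n = 2 * real k - 1" using parity by linarith
    ultimately show ?thesis unfolding of_nat_mult by (elim disjE) (simp_all only:, simp_all add: field_simps)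
  qed
  then show ?thesis using one lq_interval[OF k_def assms(1) mk] ceil by simp
qed

end
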